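(* Let $(X,\mathscr{T})$ be a weakly orderable quasi-king space, and let $\sigma$ be a separately continuous weak selection for $X$. Then $\mathscr{T}_\sigma$ is a compact topology on $X$ which is coarser than $\mathscr{T}$ (i.e. $\mathscr{T}_\sigma\subset\mathscr{T}$).
   Context: All spaces are Hausdorff topological spaces. For a set $X$, let $\mathscr{F}_2(X)=\{S\subset X: 1\le |S|\le 2\}$. A weak selection for $X$ is a map $\sigma:\mathscr{F}_2(X)\to X$ with $\sigma(S)\in S$ for every $S\in\mathscr{F}_2(X)$. It generates the (total, antisymmetric, not necessarily transitive) relation $x\leq_\sigma y$ iff $\sigma(\{x,y\})=x$; write $x<_\sigma y$ if $x\leq_\sigma y$ and $x\neq y$. The selection topology $\mathscr{T}_\sigma$ on $X$ is the topology with subbase consisting of all sets $\{y\in X: y<_\sigma x\}$ and $\{y\in X: x<_\sigma y\}$, $x\in X$. A weak selection $\sigma$ for a space $(X,\mathscr{T})$ is separately continuous if $\mathscr{T}_\sigma\subset\mathscr{T}$. A point $q\in X$ is a quasi $\sigma$-king if for each $x\in X$ there are finitely many points $y_1,\dots,y_n\in X$ with $x\leq_\sigma y_1\leq_\sigma\dots\leq_\sigma y_n\leq_\sigma q$. A space $X$ is quasi-king if it has a separately continuous weak selection, and every separately continuous weak selection $\sigma$ for $X$ has a quasi $\sigma$-king. A space $(X,\mathscr{T})$ is weakly orderable if there is a linear order $\leq$ on $X$ whose open interval topology $\mathscr{T}_\leq$ satisfies $\mathscr{T}_\leq\subset\mathscr{T}$. *)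

theory Defs
  imports "HOL-Analysis.Analysis"
begin

definition coarser :: "'a topology \<Rightarrow> 'a topology \<Rightarrow> bool" where
  "coarser S T \<longleftrightarrow> topspace S = topspace T \<and> (\<forall>U. openin S U \<longrightarrow> openin T U)"

(* relative_to makes the empty intersection equal to A, so that the underlying set is A
   even when the rays do not cover A (i.e. when A is a singleton). *)
definition open_ray_topology :: "'a set \<Rightarrow> ('a \<Rightarrow> 'a \<Rightarrow> bool) \<Rightarrow> 'a topology" where
  "open_ray_topology A lt = topology (arbitrary union_of (finite intersection_of
     (\<lambda>S. \<exists>x\<in>A. S = {y \<in> A. lt y x} \<or> S = {y \<in> A. lt x y}) relative_to A))"

lemma topspace_open_ray_topology [simp]: "topspace (open_ray_topology A lt) = A"
  unfolding open_ray_topology_def by (rule topspace_subbase)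

lemma openin_open_ray_topology:
  assumes "x \<in> A"
  shows "openin (open_ray_topology A lt) {y \<in> A. lt y x}"
    and "openin (open_ray_topology A lt) {y \<in> A. lt x y}"
proof -
  have *: "openin (open_ray_topology A lt) S"
    if "\<exists>x\<in>A. S = {y \<in> A. lt y x} \<or> S = {y \<in> A. lt x y}" for S
  proof -
    have "S \<subseteq> A" using that by auto
    with that show ?thesis
      unfolding open_ray_topology_def openin_subbase
      by (simp add: arbitrary_union_of_inc finite_intersection_of_inc relative_to_subset_inc)
  qed
  show "openin (open_ray_topology A lt) {y \<in> A. lt y x}"
    and "openin (open_ray_topology A lt) {y \<in> A. lt x y}"
    using assms by (blast intro: *)+
qed

definition F2 :: "'a set \<Rightarrow> 'a set set" where
  "F2 A = {S. S \<subseteq> A \<and> 1 \<le> card S \<and> card S \<le> 2}"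

(* Only the values of \<sigma> on F2 A are constrained, and only these are ever used. *)
definition weak_selection :: "'a set \<Rightarrow> ('a set \<Rightarrow> 'a) \<Rightarrow> bool" where
  "weak_selection A \<sigma> \<longleftrightarrow> (\<forall>S\<in>F2 A. \<sigma> S \<in> S)"

definition sel_le :: "('a set \<Rightarrow> 'a) \<Rightarrow> 'a \<Rightarrow> 'a \<Rightarrow> bool" where
  "sel_le \<sigma> x y \<longleftrightarrow> \<sigma> {x, y} = x"

definition sel_less :: "('a set \<Rightarrow> 'a) \<Rightarrow> 'a \<Rightarrow> 'a \<Rightarrow> bool" where
  "sel_less \<sigma> x y \<longleftrightarrow> sel_le \<sigma> x y \<and> x \<noteq> y"

definition selection_topology :: "'a set \<Rightarrow> ('a set \<Rightarrow> 'a) \<Rightarrow> 'a topology" where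
  "selection_topology A \<sigma> = open_ray_topology A (sel_less \<sigma>)"

lemma topspace_selection_topology [simp]: "topspace (selection_topology A \<sigma>) = A"
  by (simp add: selection_topology_def)

(* Selection topologies are Hausdorff, so for them compact_space agrees with the
   convention that compact spaces are Hausdorff. *)
lemma Hausdorff_selection_topology:
  assumes "weak_selection A \<sigma>"
  shows "Hausdorff_space (selection_topology A \<sigma>)"
proof -
  let ?T = "selection_topology A \<sigma>" and ?lt = "sel_less \<sigma>"
  have sep: "\<exists>U V. openin ?T U \<and> openin ?T V \<and> x \<in> U \<and> y \<in> V \<and> disjnt U V"
    if "x \<in> A" "y \<in> A" "?lt x y" for x y
  proof (cases "\<exists>z\<in>A. ?lt x z \<and> ?lt z y")
    case True
    then obtain z where z: "z \<in> A" "?lt x z" "?lt z y" by blast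
    have "disjnt {w \<in> A. ?lt w z} {w \<in> A. ?lt z w}"
      by (auto simp: disjnt_iff sel_less_def sel_le_def insert_commute)
    then show ?thesis
      using z that openin_open_ray_topology[OF z(1), of ?lt]
      unfolding selection_topology_def by blast
  next
    case False
    then have "disjnt {w \<in> A. ?lt w y} {w \<in> A. ?lt x w}"
      by (auto simp: disjnt_iff)
    then show ?thesis
      using that openin_open_ray_topology(1)[OF that(2), of ?lt]
        openin_open_ray_topology(2)[OF that(1), of ?lt]
      unfolding selection_topology_def by blast
  qed
  have tot: "?lt x y \<or> ?lt y x" if "x \<in> A" "y \<in> A" "x \<noteq> y" for x y
  proof -
    have "{x, y} \<in> F2 A" using that by (simp add: F2_def)
    then have "\<sigma> {x, y} \<in> {x, y}" using assms unfolding weak_selection_def by blast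
    then show ?thesis
      using that by (auto simp: sel_less_def sel_le_def insert_commute)
  qed
  show ?thesis
    unfolding Hausdorff_space_def topspace_selection_topology
    by (metis sep tot disjnt_sym)
qed

definition separately_continuous_weak_selection :: "'a topology \<Rightarrow> ('a set \<Rightarrow> 'a) \<Rightarrow> bool" where
  "separately_continuous_weak_selection T \<sigma> \<longleftrightarrow>
     weak_selection (topspace T) \<sigma> \<and> coarser (selection_topology (topspace T) \<sigma>) T"

definition quasi_king :: "'a set \<Rightarrow> ('a set \<Rightarrow> 'a) \<Rightarrow> 'a \<Rightarrow> bool" where
  "quasi_king A \<sigma> q \<longleftrightarrow> q \<in> A \<and>
     (\<forall>x\<in>A. \<exists>ys. ys \<noteq> [] \<and> set ys \<subseteq> A \<and> successively (sel_le \<sigma>) (x # ys @ [q]))"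

definition quasi_king_space :: "'a topology \<Rightarrow> bool" where
  "quasi_king_space T \<longleftrightarrow>
     (\<exists>\<sigma>. separately_continuous_weak_selection T \<sigma>) \<and>
     (\<forall>\<sigma>. separately_continuous_weak_selection T \<sigma> \<longrightarrow> (\<exists>q. quasi_king (topspace T) \<sigma> q))"

(* The open rays form a subbase of the usual open interval topology. *)
definition weakly_orderable :: "'a topology \<Rightarrow> bool" where
  "weakly_orderable T \<longleftrightarrow>
     (\<exists>r. linear_order_on (topspace T) r \<and>
          coarser (open_ray_topology (topspace T) (\<lambda>x y. (x, y) \<in> r \<and> x \<noteq> y)) T)"

end

theory Submission
  imports Defs
begin

text \<open>
  Fix a linear order whose open rays are open in \<open>T\<close>. Two observations carry the proof.

  A clopen set can be moved to the top of the order without spoiling openness of the rays, and a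
  linear order is in particular a separately continuous weak selection, for which a quasi-king is
  a greatest point. So every nonempty clopen set has a greatest point
  (\<open>clopen_has_greatest\<close>) and, by reversing the order, a least one. In particular
  the order has no gaps, so its interval topology is compact (\<open>compact_interval_topology\<close>).

  Let \<open>\<sigma>\<close> be any separately continuous weak selection. Removing a point
  \<open>x\<close> splits the space into the two open \<open>\<sigma>\<close>-rays at \<open>x\<close>. If one
  of them, containing \<open>p\<close>, were not a neighbourhood of \<open>p\<close> in the interval topology, then
  the points of the other ray would accumulate at \<open>p\<close> from one side in the order; cutting
  near \<open>p\<close> produces a clopen set having \<open>p\<close> as unattained supremum or infimum
  (\<open>neighbourhood_from_below\<close>), which has just been excluded. Hence
  the selection topology of \<open>\<sigma>\<close> is coarser than the compact interval topology, and so
  it is compact.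
\<close>

section \<open>Topologies generated by open rays\<close>

lemma coarser_open_ray_topology:
  assumes A: "topspace T = A"
    and below: "\<And>x. x \<in> A \<Longrightarrow> openin T {y \<in> A. lt y x}"
    and above: "\<And>x. x \<in> A \<Longrightarrow> openin T {y \<in> A. lt x y}"
  shows "coarser (open_ray_topology A lt) T"
proof -
  let ?P = "\<lambda>S. \<exists>x\<in>A. S = {y \<in> A. lt y x} \<or> S = {y \<in> A. lt x y}"
  have "openin T U" if "openin (open_ray_topology A lt) U" for U
    using that unfolding open_ray_topology_def
    by (rule minimal_topology_subbase[rotated 2]) (use A below above in auto)
  then show ?thesis
    by (simp add: coarser_def A)
qed

lemma open_ray_topology_dual: "open_ray_topology A (\<lambda>x y. lt y x) = open_ray_topology A lt"
  by (simp add: open_ray_topology_def disj_commute)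

lemma compact_space_coarser:
  assumes "compact_space T" "coarser S T"
  shows "compact_space S"
proof -
  have "continuous_map T S id"
    using assms(2) by (auto simp: coarser_def continuous_map_def openin_subset Int_absorb1
        simp flip: Int_def)
  then show ?thesis
    using assms image_compactin[of T "topspace T" S id]
    by (simp add: compact_space_def coarser_def)
qed

section \<open>Weak orders and clopen sets\<close>

locale weak_order =
  fixes T :: "'a topology" and lt :: "'a \<Rightarrow> 'a \<Rightarrow> bool"
  assumes irrefl: "x \<in> topspace T \<Longrightarrow> \<not> lt x x"
    and trans: "\<lbrakk>x \<in> topspace T; y \<in> topspace T; z \<in> topspace T; lt x y; lt y z\<rbrakk> \<Longrightarrow> lt x z"
    and total: "\<lbrakk>x \<in> topspace T; y \<in> topspace T\<rbrakk> \<Longrightarrow> lt x y \<or> x = y \<or> lt y x"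
    and open_below: "x \<in> topspace T \<Longrightarrow> openin T {y \<in> topspace T. lt y x}"
    and open_above: "x \<in> topspace T \<Longrightarrow> openin T {y \<in> topspace T. lt x y}"
begin

lemma asym: "\<lbrakk>x \<in> topspace T; y \<in> topspace T; lt x y\<rbrakk> \<Longrightarrow> \<not> lt y x"
  using irrefl trans by blast

lemma dual: "weak_order T (\<lambda>x y. lt y x)"
  by unfold_locales (use irrefl trans total open_below open_above in blast)+

text \<open>Selecting the smaller of two points is a separately continuous weak selection, whose
  relation is the order itself; since the order is transitive, the finite chains leading to a
  quasi-king collapse to single comparisons.\<close>

lemma has_greatest:
  assumes "quasi_king_space T"
  obtains q where "q \<in> topspace T" "\<And>x. x \<in> topspace T \<Longrightarrow> x = q \<or> lt x q"
proof -
  let ?A = "topspace T"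
  define \<tau> where "\<tau> S = (SOME m. m \<in> S \<and> (\<forall>y\<in>S. y \<noteq> m \<longrightarrow> lt m y))" for S
  have \<tau>_left: "\<tau> {x, y} = x" if "x \<in> ?A" "y \<in> ?A" "x = y \<or> lt x y" for x y
    unfolding \<tau>_def by (rule some_equality) (use that asym in auto)
  have \<tau>_right: "\<tau> {x, y} = y" if "x \<in> ?A" "y \<in> ?A" "lt y x" for x y
    using \<tau>_left[of y x] that by (simp add: insert_commute)
  have le: "sel_le \<tau> x y \<longleftrightarrow> x = y \<or> lt x y" if "x \<in> ?A" "y \<in> ?A" for x y
    using \<tau>_left[OF that] \<tau>_right[OF that] total[OF that] unfolding sel_le_def by auto
  have less: "sel_less \<tau> x y \<longleftrightarrow> lt x y" if "x \<in> ?A" "y \<in> ?A" for x y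
    using le[OF that] irrefl that unfolding sel_less_def by auto
  have "\<tau> S \<in> S" if "S \<in> F2 ?A" for S
  proof -
    have "card S = 1 \<or> card S = 2" using that by (auto simp: F2_def)
    then obtain x y where "S = {x, y}"
      by (metis card_1_singletonE card_2_iff insert_absorb2)
    then show ?thesis
      using that \<tau>_left[of x y] \<tau>_right[of x y] total[of x y] by (auto simp: F2_def)
  qed
  moreover have "coarser (selection_topology ?A \<tau>) T"
    unfolding selection_topology_def
  proof (rule coarser_open_ray_topology)
    fix x assume x: "x \<in> ?A"
    have "{y \<in> ?A. sel_less \<tau> y x} = {y \<in> ?A. lt y x}"
      "{y \<in> ?A. sel_less \<tau> x y} = {y \<in> ?A. lt x y}"
      using less x by auto
    then show "openin T {y \<in> ?A. sel_less \<tau> y x}" "openin T {y \<in> ?A. sel_less \<tau> x y}"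
      using open_below[OF x] open_above[OF x] by simp_all
  qed simp
  ultimately obtain q where q: "quasi_king ?A \<tau> q"
    using assms unfolding quasi_king_space_def separately_continuous_weak_selection_def
      weak_selection_def by blast
  have qA: "q \<in> ?A" using q by (simp add: quasi_king_def)
  have chain: "x = q \<or> lt x q"
    if "successively (sel_le \<tau>) (x # ys @ [q])" "set ys \<subseteq> ?A" "x \<in> ?A" for x ys
    using that
  proof (induction ys arbitrary: x)
    case Nil
    then show ?case using le qA by simp
  next
    case (Cons y ys)
    then have "y = q \<or> lt y q" "x = y \<or> lt x y" "y \<in> ?A"
      using le by auto
    then show ?case using trans[of x y q] Cons.prems qA by auto
  qed
  show ?thesis
    using that[OF qA] q chain unfolding quasi_king_def by blast
qed

text \<open>Move the clopen set above all other points: the order so obtained is again a weak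
  order, and its greatest point is the greatest point of the set.\<close>

lemma clopen_has_greatest:
  assumes king: "quasi_king_space T"
    and U: "openin T U" "openin T (topspace T - U)" "U \<noteq> {}"
  shows "\<exists>m\<in>U. \<forall>y\<in>U. y = m \<or> lt y m"
proof -
  let ?A = "topspace T"
  have UA: "U \<subseteq> ?A" using U(1) by (rule openin_subset)
  define lt' where "lt' x y \<longleftrightarrow> x \<notin> U \<and> y \<in> U \<or> (x \<in> U \<longleftrightarrow> y \<in> U) \<and> lt x y" for x y
  have "weak_order T lt'"
  proof
    fix x assume x: "x \<in> ?A"
    show "\<not> lt' x x" using irrefl x by (simp add: lt'_def)
    have "{y \<in> ?A. lt' y x} = (if x \<in> U then (?A - U) \<union> (U \<inter> {y \<in> ?A. lt y x})
        else (?A - U) \<inter> {y \<in> ?A. lt y x})"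
      using UA by (auto simp: lt'_def)
    then show "openin T {y \<in> ?A. lt' y x}"
      using U open_below[OF x] by (simp add: openin_Un openin_Int)
    have "{y \<in> ?A. lt' x y} = (if x \<in> U then U \<inter> {y \<in> ?A. lt x y}
        else U \<union> ((?A - U) \<inter> {y \<in> ?A. lt x y}))"
      using UA by (auto simp: lt'_def)
    then show "openin T {y \<in> ?A. lt' x y}"
      using U open_above[OF x] by (simp add: openin_Un openin_Int)
    fix y assume y: "y \<in> ?A"
    show "lt' x y \<or> x = y \<or> lt' y x" using total[OF x y] by (auto simp: lt'_def)
    fix z assume z: "z \<in> ?A" and "lt' x y" "lt' y z"
    then show "lt' x z" using trans[OF x y z] by (auto simp: lt'_def)
  qed
  then obtain m where m: "m \<in> ?A" "\<And>x. x \<in> ?A \<Longrightarrow> x = m \<or> lt' x m"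
    using weak_order.has_greatest[OF _ king] by blast
  have "m \<in> U" using U(3) UA m by (auto simp: lt'_def)
  then show ?thesis
    using m UA by (intro bexI[of _ m]) (auto simp: lt'_def)
qed

end

section \<open>Weak orders on quasi-king spaces\<close>

locale quasi_king_order = weak_order +
  assumes king: "quasi_king_space T"
begin

abbreviation "interval_topology \<equiv> open_ray_topology (topspace T) lt"

lemma dual_king: "quasi_king_order T (\<lambda>x y. lt y x)"
  using dual king by (simp add: quasi_king_order_def quasi_king_order_axioms_def)

lemma clopen_greatest:
  assumes "openin T U" "openin T (topspace T - U)" "U \<noteq> {}"
  shows "\<exists>m\<in>U. \<forall>y\<in>U. y = m \<or> lt y m"
  using clopen_has_greatest[OF king assms] by blast

lemma clopen_least:
  assumes "openin T U" "openin T (topspace T - U)" "U \<noteq> {}"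
  shows "\<exists>m\<in>U. \<forall>y\<in>U. y = m \<or> lt m y"
  using weak_order.clopen_has_greatest[OF dual king assms] by blast

text \<open>In a cover by rays, let \<open>P\<close> and \<open>Q\<close> be the sets of end points of the lower and of
  the upper rays. If some point of \<open>Q\<close> lies below some point of \<open>P\<close>, the two rays at these
  points cover everything. Otherwise the lower rays and the upper rays have disjoint unions
  \<open>L\<close> and \<open>R\<close>, so both unions are clopen. But a greatest point of \<open>L\<close> lies below some
  \<open>a \<in> P\<close>, and \<open>a\<close> is then covered by an upper ray after all; dually for \<open>R\<close>.\<close>

lemma ray_cover_two:
  assumes sub: "P \<subseteq> topspace T" "Q \<subseteq> topspace T" and ne: "topspace T \<noteq> {}"
    and cover: "\<And>y. y \<in> topspace T \<Longrightarrow> (\<exists>a\<in>P. lt y a) \<or> (\<exists>b\<in>Q. lt b y)"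
  obtains a b where "a \<in> P" "b \<in> Q" "lt b a"
proof -
  let ?A = "topspace T"
  define L where "L = (\<Union>a\<in>P. {y \<in> ?A. lt y a})"
  define R where "R = (\<Union>b\<in>Q. {y \<in> ?A. lt b y})"
  have "\<exists>a\<in>P. \<exists>b\<in>Q. lt b a"
  proof (rule ccontr)
    assume no: "\<not> ?thesis"
    have "openin T {y \<in> ?A. lt y a}" if "a \<in> P" for a
      using open_below sub that by blast
    then have opnL: "openin T L"
      unfolding L_def by (intro openin_Union) auto
    have "openin T {y \<in> ?A. lt b y}" if "b \<in> Q" for b
      using open_above sub that by blast
    then have opnR: "openin T R"
      unfolding R_def by (intro openin_Union) auto
    have False if y: "y \<in> L" "y \<in> R" for y
    proof -
      obtain a b where "a \<in> P" "lt y a" "b \<in> Q" "lt b y" "y \<in> ?A"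
        using y unfolding L_def R_def by blast
      then show False using no sub trans[of b y a] by blast
    qed
    moreover have "L \<union> R = ?A"
      using cover by (auto simp: L_def R_def)
    ultimately have eq: "?A - L = R" "?A - R = L"
      by blast+
    have "L \<noteq> {} \<or> R \<noteq> {}"
      using eq ne by blast
    then show False
    proof
      assume "L \<noteq> {}"
      then obtain m where m: "m \<in> L" "\<And>y. y \<in> L \<Longrightarrow> y = m \<or> lt y m"
        using clopen_greatest[of L] opnL opnR eq by metis
      then obtain a where a: "a \<in> P" "lt m a" "m \<in> ?A" by (auto simp: L_def)
      then have aA: "a \<in> ?A" using sub by blast
      then have "a \<notin> L" using m(2)[of a] asym[of m a] irrefl[of m] a by auto
      then have "a \<in> R" using eq aA by blast
      then show False using no a(1) by (auto simp: R_def)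
    next
      assume "R \<noteq> {}"
      then obtain m where m: "m \<in> R" "\<And>y. y \<in> R \<Longrightarrow> y = m \<or> lt m y"
        using clopen_least[of R] opnL opnR eq by metis
      then obtain b where b: "b \<in> Q" "lt b m" "m \<in> ?A" by (auto simp: R_def)
      then have bA: "b \<in> ?A" using sub by blast
      then have "b \<notin> R" using m(2)[of b] asym[of b m] irrefl[of m] b by auto
      then have "b \<in> L" using eq bA by blast
      then show False using no b(1) by (auto simp: L_def)
    qed
  qed
  then show ?thesis using that by blast
qed

lemma compact_interval_topology: "compact_space interval_topology"
proof -
  let ?A = "topspace T"
  define below where "below a = {y \<in> ?A. lt y a}" for a
  define above where "above b = {y \<in> ?A. lt b y}" for b
  define B where "B = below ` ?A \<union> above ` ?A"
  show ?thesis
  proof (cases "?A \<subseteq> \<Union>B")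
    case False
    \<comment> \<open>A point on no ray is comparable to no other point, so it is the only one.\<close>
    then obtain p where p: "p \<in> ?A" "p \<notin> \<Union>B" by blast
    have "?A \<subseteq> {p}"
    proof
      fix y assume "y \<in> ?A"
      then show "y \<in> {p}"
        using p total[of y p] by (auto simp: B_def below_def above_def)
    qed
    then have "finite ?A"
      using finite_subset by blast
    then show ?thesis
      by (simp add: compact_space_def finite_imp_compactin)
  next
    case True
    show ?thesis
    proof (rule Alexander_subbase_alt)
      show "?A \<subseteq> \<Union>B" by (fact True)
      have "(\<lambda>S. S \<in> B) = (\<lambda>S. \<exists>x\<in>?A. S = {y \<in> ?A. lt y x} \<or> S = {y \<in> ?A. lt x y})"
        by (auto simp: B_def below_def above_def fun_eq_iff)
      then show "topology (arbitrary union_of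
          (finite intersection_of (\<lambda>S. S \<in> B) relative_to ?A)) = interval_topology"
        by (simp add: open_ray_topology_def)
      fix C assume C: "C \<subseteq> B" "?A \<subseteq> \<Union>C"
      show "\<exists>C'. finite C' \<and> C' \<subseteq> C \<and> ?A \<subseteq> \<Union>C'"
      proof (cases "?A = {}")
        case True
        then show ?thesis by (intro exI[of _ "{}"]) simp
      next
        case False
        define P where "P = {a \<in> ?A. below a \<in> C}"
        define Q where "Q = {b \<in> ?A. above b \<in> C}"
        have "(\<exists>a\<in>P. lt y a) \<or> (\<exists>b\<in>Q. lt b y)" if "y \<in> ?A" for y
        proof -
          obtain S where "S \<in> C" "y \<in> S" using C(2) \<open>y \<in> ?A\<close> by blast
          moreover from this have "S \<in> below ` ?A \<or> S \<in> above ` ?A"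
            using C(1) by (auto simp: B_def)
          ultimately show ?thesis
            by (auto simp: P_def Q_def below_def above_def)
        qed
        then obtain a b where ab: "a \<in> P" "b \<in> Q" "lt b a"
          using ray_cover_two[of P Q] False by (auto simp: P_def Q_def)
        then have abA: "a \<in> ?A" "b \<in> ?A" by (auto simp: P_def Q_def)
        have "?A \<subseteq> below a \<union> above b"
        proof
          fix y assume y: "y \<in> ?A"
          have "lt y a \<or> lt b y"
            using total[OF y abA(1)] trans[OF abA(2,1) y ab(3)] ab(3) by blast
          then show "y \<in> below a \<union> above b"
            using y by (auto simp: below_def above_def)
        qed
        then show ?thesis
          using ab by (intro exI[of _ "{below a, above b}"]) (auto simp: P_def Q_def)
      qed
    qed
  qed
qed

section \<open>Comparing a splitting at a point with the order\<close>

text \<open>This is one half of the openness of \<open>G\<close> at \<open>p\<close>; the other half is its order dual.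
  If it fails, then points of \<open>H\<close> accumulate at \<open>p\<close> from below.
  Consider the part \<open>D\<close> below \<open>p\<close>, cut off at \<open>x\<close> if necessary so that \<open>x\<close> is out of the way.
  If \<open>D\<close> contains some \<open>e \<in> G\<close>, then the points of \<open>H\<close> between \<open>e\<close> and \<open>p\<close> form a clopen set,
  because the end points lie in the open set \<open>G\<close>.
  If \<open>D\<close> misses \<open>G\<close>, then the lower ray at \<open>p\<close> is clopen. Neither set has a greatest point.\<close>

lemma neighbourhood_from_below:
  assumes G: "openin T G" and H: "openin T H" and disj: "G \<inter> H = {}"
    and split: "G \<union> H = topspace T - {x}" and x: "x \<in> topspace T" and p: "p \<in> G"
  shows "\<exists>E. openin interval_topology E \<and> p \<in> E \<and> (\<forall>y\<in>E. lt y p \<longrightarrow> y \<in> G)"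
proof (rule ccontr)
  assume no: "\<not> ?thesis"
  let ?A = "topspace T"
  have GA: "G \<subseteq> ?A" and pA: "p \<in> ?A" and xp: "x \<noteq> p"
    using split p by auto
  have nonempty: "\<exists>y\<in>?A. lt y p \<and> y \<notin> G"
  proof -
    have "openin interval_topology ?A"
      using openin_topspace[of interval_topology] by simp
    then show ?thesis using no pA by blast
  qed
  have cofinal: "\<exists>y\<in>?A. lt e y \<and> lt y p \<and> y \<notin> G" if "e \<in> ?A" "lt e p" for e
  proof -
    have "p \<in> {y \<in> ?A. lt e y}" using pA that by simp
    then show ?thesis
      using no openin_open_ray_topology(2)[OF that(1), of lt] by blast
  qed
  define D where "D = {y \<in> ?A. lt y p \<and> (lt x p \<longrightarrow> lt x y)}"
  show False
  proof (cases "D \<inter> G = {}")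
    case False
    then obtain e where e: "e \<in> ?A" "lt e p" "lt x p \<longrightarrow> lt x e" "e \<in> G"
      by (auto simp: D_def)
    let ?M = "H \<inter> {y \<in> ?A. lt e y} \<inter> {y \<in> ?A. lt y p}"
    have in_M: "y \<in> ?M" if "y \<in> ?A" "lt e y" "lt y p" "y \<notin> G" for y
    proof -
      have "y \<noteq> x"
        using that e x pA xp total[of x p] asym[of x e] asym[of x p] by blast
      then show ?thesis using that split by blast
    qed
    have "?A - ?M = {y \<in> ?A. lt y e} \<union> {y \<in> ?A. lt p y} \<union> G"
    proof (intro equalityI subsetI)
      fix y assume y: "y \<in> ?A - ?M"
      then show "y \<in> {y \<in> ?A. lt y e} \<union> {y \<in> ?A. lt p y} \<union> G"
        using in_M[of y] total[of y e] total[of y p] e p pA by blast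
    next
      fix y assume "y \<in> {y \<in> ?A. lt y e} \<union> {y \<in> ?A. lt p y} \<union> G"
      then show "y \<in> ?A - ?M"
        using asym[of y e] asym[of p y] e pA GA disj by blast
    qed
    then have M_compl: "openin T (?A - ?M)"
      using open_below[OF e(1)] open_above[OF pA] G by (simp only: openin_Un)
    have M_open: "openin T ?M"
      using open_below[OF pA] open_above[OF e(1)] H by blast
    have M_ne: "?M \<noteq> {}"
      using cofinal[OF e(1,2)] in_M by blast
    obtain m where m: "m \<in> ?M" "\<And>y. y \<in> ?M \<Longrightarrow> y = m \<or> lt y m"
      using clopen_greatest[OF M_open M_compl M_ne] by blast
    then obtain y where y: "y \<in> ?A" "lt m y" "lt y p" "y \<notin> G"
      using cofinal[of m] by blast
    then have "y \<in> ?M" using in_M[of y] trans[of e m y] m(1) e by blast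
    then show False
      using m y asym[of m y] irrefl[of m] by blast
  next
    case True
    let ?M = "{y \<in> ?A. lt y p}"
    let ?N = "if lt x p then G \<inter> {y \<in> ?A. lt x y} else G"
    have "?A - ?M = {y \<in> ?A. lt p y} \<union> ?N"
    proof (intro equalityI subsetI)
      fix y assume "y \<in> ?A - ?M"
      then show "y \<in> {y \<in> ?A. lt p y} \<union> ?N"
        using total[of y p] p pA by auto
    next
      fix y assume "y \<in> {y \<in> ?A. lt p y} \<union> ?N"
      then show "y \<in> ?A - ?M"
        using True GA asym[of p y] pA by (auto simp: D_def split: if_splits)
    qed
    moreover have "openin T ?N"
      using G open_above[OF x] by auto
    ultimately have M_compl: "openin T (?A - ?M)"
      using open_above[OF pA] by (simp only: openin_Un)
    have M_ne: "?M \<noteq> {}"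
      using nonempty by blast
    obtain m where m: "m \<in> ?M" "\<And>y. y \<in> ?M \<Longrightarrow> y = m \<or> lt y m"
      using clopen_greatest[OF open_below[OF pA] M_compl M_ne] by blast
    then obtain y where "y \<in> ?A" "lt m y" "lt y p" using cofinal[of m] by blast
    then show False
      using m(1) m(2)[of y] asym[of m y] irrefl[of m] by blast
  qed
qed

lemma split_open_in_interval_topology:
  assumes G: "openin T G" and H: "openin T H" and disj: "G \<inter> H = {}"
    and split: "G \<union> H = topspace T - {x}" and x: "x \<in> topspace T"
  shows "openin interval_topology G"
proof (subst openin_subopen, intro ballI)
  fix p assume p: "p \<in> G"
  have pA: "p \<in> topspace T" using split p by blast
  obtain E where E: "openin interval_topology E" "p \<in> E"
    "\<And>y. y \<in> E \<Longrightarrow> lt y p \<Longrightarrow> y \<in> G"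
    using neighbourhood_from_below[OF assms p] by blast
  obtain F where F: "openin interval_topology F" "p \<in> F"
    "\<And>y. y \<in> F \<Longrightarrow> lt p y \<Longrightarrow> y \<in> G"
    using quasi_king_order.neighbourhood_from_below[OF dual_king assms p]
    unfolding open_ray_topology_dual[of _ lt] by blast
  have "E \<inter> F \<subseteq> G"
  proof
    fix y assume y: "y \<in> E \<inter> F"
    then have "y \<in> topspace T" using openin_subset[OF E(1)] by auto
    then show "y \<in> G" using total[of y p] y E(3) F(3) p pA by blast
  qed
  then show "\<exists>N. openin interval_topology N \<and> p \<in> N \<and> N \<subseteq> G"
    using E F openin_Int by blast
qed

lemma selection_topology_coarser_interval_topology:
  assumes \<sigma>: "separately_continuous_weak_selection T \<sigma>"
  shows "coarser (selection_topology (topspace T) \<sigma>) interval_topology"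
  unfolding selection_topology_def
proof (rule coarser_open_ray_topology)
  let ?A = "topspace T"
  fix x assume x: "x \<in> ?A"
  let ?G = "{y \<in> ?A. sel_less \<sigma> y x}" and ?H = "{y \<in> ?A. sel_less \<sigma> x y}"
  have opn: "openin T ?G" "openin T ?H"
    using \<sigma> openin_open_ray_topology[OF x, of "sel_less \<sigma>"]
    by (auto simp: separately_continuous_weak_selection_def coarser_def selection_topology_def)
  have disj: "?G \<inter> ?H = {}"
    by (auto simp: sel_less_def sel_le_def insert_commute)
  have "sel_less \<sigma> y x \<or> sel_less \<sigma> x y" if "y \<in> ?A" "y \<noteq> x" for y
  proof -
    have "{x, y} \<in> F2 ?A" using that x by (simp add: F2_def)
    then have "\<sigma> {x, y} \<in> {x, y}"
      using \<sigma> unfolding separately_continuous_weak_selection_def weak_selection_def by blast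
    then show ?thesis
      using that by (auto simp: sel_less_def sel_le_def insert_commute)
  qed
  then have split: "?G \<union> ?H = ?A - {x}"
    by (auto simp: sel_less_def)
  show "openin interval_topology ?G"
    using opn disj split x by (rule split_open_in_interval_topology)
  show "openin interval_topology ?H"
    using split_open_in_interval_topology[OF opn(2,1) _ _ x] disj split by blast
qed simp

end

section \<open>Compactness of selection topologies\<close>

theorem theorem5p1:
  fixes T :: "'a topology" and \<sigma> :: "'a set \<Rightarrow> 'a"
  assumes "Hausdorff_space T"
    and "weakly_orderable T"
    and "quasi_king_space T"
    and "separately_continuous_weak_selection T \<sigma>"
  shows "topspace (selection_topology (topspace T) \<sigma>) = topspace T
    \<and> compact_space (selection_topology (topspace T) \<sigma>)
    \<and> coarser (selection_topology (topspace T) \<sigma>) T"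
proof -
  let ?A = "topspace T"
  obtain r where r: "linear_order_on ?A r"
    and coarse: "coarser (open_ray_topology ?A (\<lambda>x y. (x, y) \<in> r \<and> x \<noteq> y)) T"
    using assms(2) unfolding weakly_orderable_def by (elim exE conjE)
  let ?lt = "\<lambda>x y. (x, y) \<in> r \<and> x \<noteq> y"
  have ord: "trans r" "antisym r" "total_on ?A r"
    using r unfolding linear_order_on_def partial_order_on_def preorder_on_def by blast+
  have coarse_open: "openin T U" if "openin (open_ray_topology ?A ?lt) U" for U
    using coarse that unfolding coarser_def by blast
  interpret quasi_king_order T ?lt
  proof
    fix x assume x: "x \<in> ?A"
    show "openin T {y \<in> ?A. ?lt y x}" "openin T {y \<in> ?A. ?lt x y}"
      by (rule coarse_open, rule openin_open_ray_topology[OF x])+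
    fix y assume y: "y \<in> ?A"
    show "?lt x y \<or> x = y \<or> ?lt y x"
      using ord(3) x y by (auto simp: total_on_def)
    fix z assume "?lt x y" "?lt y z"
    then show "?lt x z"
      using transD[OF ord(1), of x y z] antisymD[OF ord(2), of x y] by blast
  qed (simp_all add: assms(3))
  have "compact_space (selection_topology ?A \<sigma>)"
    using compact_interval_topology selection_topology_coarser_interval_topology[OF assms(4)]
    by (rule compact_space_coarser)
  then show ?thesis
    using assms(4) by (simp add: separately_continuous_weak_selection_def)
qed

end
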